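(* For every dimension $d$ there is a constant $C_d>0$, depending only on $d$, such that the following holds. Suppose $\Omega\subseteq\mathbb{R}^d$ is measurable with positive Lebesgue measure, and $\Lambda\subseteq\mathbb{R}^d$ is a point set such that $E_\Lambda=\{e^{2\pi i x\cdot\lambda}\}_{\lambda\in\Lambda}$ is a frame for $L^2(\Omega)$ with lower and upper frame constants $A$ and $B$, respectively. Let $R>0$ be such that there is a cube in $\mathbb{R}^d$ of side-length $R$ containing no point of $\Lambda$. Finally, assume that $\Omega$ contains a cube of side-length $\epsilon>0$. Then $$R \le C_d\,\frac{B}{A}\,\epsilon^{-1}.$$
   Context: $E_\Lambda$ is a frame for $L^2(\Omega)$ with lower and upper frame constants $A,B>0$ if for all $g\in L^2(\Omega)$ $$A\,\|g\|_{L^2(\Omega)}^2\le\sum_{\lambda\in\Lambda}|\hat g(\lambda)|^2\le B\,\|g\|_{L^2(\Omega)}^2,$$ where $\hat g(\xi)=\int_\Omega g(x)e^{-2\pi i x\cdot \xi}\,dx$ is the Fourier transform of $g$ (extended by zero outside $\Omega$). Only the ratio $B/A$ enters the conclusion, so the normalization of the Fourier transform or frame constants is immaterial. Cubes are axis-parallel. *)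

theory Defs
  imports "HOL-Analysis.Analysis"
begin

text \<open>Representatives of the elements of the complex Hilbert space \<open>L\<^sup>2(\<Omega>)\<close>.\<close>

definition L2_on :: "(real ^ 'n) set \<Rightarrow> (real ^ 'n \<Rightarrow> complex) set" where
  "L2_on \<Omega> = {g. g \<in> borel_measurable (lebesgue_on \<Omega>) \<and>
                 integrable (lebesgue_on \<Omega>) (\<lambda>x. (norm (g x))\<^sup>2)}"

definition L2_norm_on :: "(real ^ 'n) set \<Rightarrow> (real ^ 'n \<Rightarrow> complex) \<Rightarrow> real" where
  "L2_norm_on \<Omega> g = sqrt (LINT x|lebesgue_on \<Omega>. (norm (g x))\<^sup>2)"

definition fourier_on :: "(real ^ 'n) set \<Rightarrow> (real ^ 'n \<Rightarrow> complex) \<Rightarrow> real ^ 'n \<Rightarrow> complex" where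
  "fourier_on \<Omega> g \<xi> =
     (LINT x|lebesgue_on \<Omega>. g x * exp (- 2 * of_real pi * \<i> * of_real (x \<bullet> \<xi>)))"

definition exponential :: "real ^ 'n \<Rightarrow> real ^ 'n \<Rightarrow> complex" where
  "exponential \<xi> x = exp (2 * of_real pi * \<i> * of_real (x \<bullet> \<xi>))"

text \<open>A frame of a Hilbert space consists of elements of that space. The membership clause
  therefore is part of the notion; together with the lower bound it forces \<open>\<Omega>\<close> to have finite
  measure, so that \<open>L\<^sup>2(\<Omega>) \<subseteq> L\<^sup>1(\<Omega>)\<close> and \<open>fourier_on\<close> is a genuine integral.\<close>

definition exponential_frame ::
  "(real ^ 'n) set \<Rightarrow> (real ^ 'n) set \<Rightarrow> real \<Rightarrow> real \<Rightarrow> bool" where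
  "exponential_frame \<Omega> \<Lambda> A B \<longleftrightarrow>
     0 < A \<and> 0 < B \<and>
     (\<forall>\<xi>\<in>\<Lambda>. exponential \<xi> \<in> L2_on \<Omega>) \<and>
     (\<forall>g\<in>L2_on \<Omega>.
        (\<lambda>\<xi>. (norm (fourier_on \<Omega> g \<xi>))\<^sup>2) summable_on \<Lambda> \<and>
        A * (L2_norm_on \<Omega> g)\<^sup>2 \<le> (\<Sum>\<^sub>\<infinity>\<xi>\<in>\<Lambda>. (norm (fourier_on \<Omega> g \<xi>))\<^sup>2) \<and>
        (\<Sum>\<^sub>\<infinity>\<xi>\<in>\<Lambda>. (norm (fourier_on \<Omega> g \<xi>))\<^sup>2) \<le> B * (L2_norm_on \<Omega> g)\<^sup>2)"

text \<open>Axis-parallel cubes of side-length \<open>r\<close>; open, closed and half-open ones are all allowed.\<close>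

definition is_cube :: "real \<Rightarrow> (real ^ 'n) set \<Rightarrow> bool" where
  "is_cube r Q \<longleftrightarrow> (\<exists>a. box a (a + vec r) \<subseteq> Q \<and> Q \<subseteq> cbox a (a + vec r))"

end

theory Submission
  imports Defs
begin

text \<open>
  The idea is to test the frame inequality on differences of translates of a small cube, for
  which both sides can be controlled without computing any Fourier transform and without counting
  the points of \<open>\<Lambda>\<close> in cubes.

  Let \<open>c\<close> be the centre of the cube of side \<open>R\<close> that \<open>\<Lambda>\<close> misses, let \<open>S\<close> be a cube of side
  \<open>s = \<epsilon> / 2\<close> sharing a corner \<open>b\<close> with the cube in \<open>\<Omega>\<close>, and let \<open>F\<close> be the Fourier transform of
  \<open>1\<^sub>S\<close>. Every \<open>\<xi> \<in> \<Lambda>\<close> has some coordinate with \<open>\<bar>\<xi>\<^sub>j - c\<^sub>j\<bar> \<ge> R / 2\<close>. Fix \<open>j\<close> and look at those \<open>\<xi>\<close>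
  only. For \<open>0 \<le> t \<le> s\<close> the function \<open>h\<^sub>t = e\<^sub>c (1\<^sub>S - 1\<^bsub>S + t e\<^sub>j\<^esub>)\<close>, with \<open>e\<^sub>c\<close> the
  exponential of frequency \<open>c\<close>, still lives in \<open>\<Omega>\<close>, and

  \<^item> its transform at \<open>\<xi>\<close> is \<open>F (\<xi> - c) (1 - exp (-2 \<pi> i t (\<xi>\<^sub>j - c\<^sub>j)))\<close>
    (\<open>modulated_indicator_fourier\<close>, \<open>fourier_indicator_translate\<close>);

  \<^item> its squared norm is the measure of a symmetric difference of two nearby cubes, so at most
    \<open>2 t s\<^bsup>d-1\<^esup>\<close> (\<open>cube_translate_sym_diff_measure\<close>).

  For a single \<open>t\<close> the factor \<open>1 - exp (\<dots>)\<close> may vanish, but its squared modulus has mean at least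
  1 over \<open>0 \<le> t \<le> 1 / R\<close>, because \<open>\<bar>\<xi>\<^sub>j - c\<^sub>j\<bar> \<ge> R / 2\<close> makes it run through enough of a period
  (\<open>norm_one_minus_character_integral\<close>). Averaging the upper frame bounds for the \<open>h\<^sub>t\<close> therefore
  bounds the sum of \<open>\<bar>F (\<xi> - c)\<bar>\<^sup>2\<close> over these \<open>\<xi>\<close> by \<open>2 B s\<^bsup>d-1\<^esup> / R\<close> (\<open>cube_transform_tail\<close>).
  Summing over \<open>j\<close> and comparing with the lower frame bound \<open>A s\<^sup>d\<close> for \<open>e\<^sub>c 1\<^sub>S\<close> gives
  \<open>A s \<le> 2 d B / R\<close>, which is the claim with the constant \<open>4 d\<close>. The translations stay inside
  \<open>\<Omega>\<close> only if \<open>1 / R \<le> s\<close>; otherwise \<open>R \<epsilon> < 2\<close>, and \<open>A \<le> B\<close> suffices.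
\<close>

section \<open>Modulated indicator functions and their translates\<close>

text \<open>Only differences of indicators are ever tested, and their norms are measures of symmetric
  differences. The choice \<open>T = {}\<close> covers a single cube. Multiplying by \<open>exponential c\<close> moves the
  frequency \<open>c\<close> to the origin.\<close>

lemma
  fixes S T \<Omega> :: "(real ^ 'n) set"
  assumes \<Omega>: "\<Omega> \<in> sets lebesgue"
    and S: "S \<in> sets borel" "emeasure lborel S < \<infinity>" "S \<subseteq> \<Omega>"
    and T: "T \<in> sets borel" "emeasure lborel T < \<infinity>" "T \<subseteq> \<Omega>"
  defines "g \<equiv> \<lambda>c x. exponential c x * (indicator S x - indicator T x)"
  shows modulated_indicator_L2: "g c \<in> L2_on \<Omega>"
    and modulated_indicator_norm: "(L2_norm_on \<Omega> (g c))\<^sup>2 = measure lborel (sym_diff S T)"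
    and modulated_indicator_fourier:
      "fourier_on \<Omega> (g c) \<xi> = fourier_on S (\<lambda>_. 1) (\<xi> - c) - fourier_on T (\<lambda>_. 1) (\<xi> - c)"
proof -
  have D: "sym_diff S T \<in> sets borel" "sym_diff S T \<subseteq> \<Omega>"
    using S T by auto
  have "emeasure lborel (sym_diff S T) \<le> emeasure lborel (S \<union> T)"
    using S T by (intro emeasure_mono) auto
  also have "\<dots> \<le> emeasure lborel S + emeasure lborel T"
    using S T by (intro emeasure_subadditive) auto
  also have "\<dots> < \<infinity>"
    using S T by (simp add: less_top)
  finally have finD: "emeasure lborel (sym_diff S T) < \<infinity>" .
  have sq: "(norm (g c x))\<^sup>2 = indicator (sym_diff S T) x" for x
    by (auto simp: g_def norm_mult exponential_def indicator_def)
  have e_meas: "exponential c \<in> borel_measurable borel"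
    unfolding exponential_def by (intro borel_measurable_continuous_onI continuous_intros)
  have "g c \<in> borel_measurable borel"
    unfolding g_def using e_meas S T by measurable
  then have "g c \<in> borel_measurable lebesgue"
    by (simp add: borel_measurable_if_I measurable_completion)
  then have meas: "g c \<in> borel_measurable (lebesgue_on \<Omega>)"
    by (rule measurable_restrict_space1)
  have mo: "measure (lebesgue_on \<Omega>) (sym_diff S T) = measure lborel (sym_diff S T)"
    using D \<Omega> by (simp add: measure_restrict_space)
  have eo: "emeasure (lebesgue_on \<Omega>) (sym_diff S T) = emeasure lborel (sym_diff S T)"
    using D \<Omega> by (simp add: emeasure_restrict_space)
  have so: "sym_diff S T \<in> sets (lebesgue_on \<Omega>)"
    using D \<Omega> by (auto simp: sets_restrict_space_iff)
  show "g c \<in> L2_on \<Omega>"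
    using meas so eo finD by (simp add: L2_on_def sq integrable_indicator_iff Int_absorb2[OF D(2)])
  show "(L2_norm_on \<Omega> (g c))\<^sup>2 = measure lborel (sym_diff S T)"
    using so mo by (simp add: L2_norm_on_def sq Int_absorb2[OF D(2)])
  define e :: "real ^ 'n \<Rightarrow> complex"
    where "e x = exp (- 2 * of_real pi * \<i> * of_real (x \<bullet> (\<xi> - c)))" for x
  have e_meas: "e \<in> borel_measurable borel"
    unfolding e_def by (intro borel_measurable_continuous_onI continuous_intros)
  have e_norm: "norm (e x) = 1" for x
    unfolding e_def by simp
  have on: "fourier_on X (\<lambda>_. 1) (\<xi> - c) = (LINT x|lebesgue_on \<Omega>. indicator X x *\<^sub>R e x)"
    and int: "integrable (lebesgue_on \<Omega>) (\<lambda>x. indicator X x *\<^sub>R e x)"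
    if X: "X \<in> sets borel" "emeasure lborel X < \<infinity>" "X \<subseteq> \<Omega>" for X
  proof -
    have "fourier_on X (\<lambda>_. 1) (\<xi> - c) = (LINT x|lebesgue. indicator X x *\<^sub>R e x)"
      unfolding fourier_on_def using X(1) by (simp add: integral_restrict_space e_def)
    also have "(\<lambda>x. indicator X x *\<^sub>R e x) = (\<lambda>x. indicator \<Omega> x *\<^sub>R (indicator X x *\<^sub>R e x))"
      using X(3) by (auto simp: indicator_def fun_eq_iff)
    finally show "fourier_on X (\<lambda>_. 1) (\<xi> - c) = (LINT x|lebesgue_on \<Omega>. indicator X x *\<^sub>R e x)"
      using \<Omega> by (simp add: integral_restrict_space)
    have "integrable (lebesgue_on \<Omega>) (indicator X :: _ \<Rightarrow> real)"
      using X \<Omega> by (simp add: integrable_indicator_iff sets_restrict_space_iff emeasure_restrict_space Int_absorb2)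
    then show "integrable (lebesgue_on \<Omega>) (\<lambda>x. indicator X x *\<^sub>R e x)"
    proof (rule Bochner_Integration.integrable_bound)
      have "(\<lambda>x. indicator X x *\<^sub>R e x) \<in> borel_measurable borel"
        using e_meas X by measurable
      then show "(\<lambda>x. indicator X x *\<^sub>R e x) \<in> borel_measurable (lebesgue_on \<Omega>)"
        by (intro measurable_restrict_space1 measurable_completion) simp
    qed (simp add: e_norm)
  qed
  have ge: "g c x * exp (- 2 * of_real pi * \<i> * of_real (x \<bullet> \<xi>))
      = indicator S x *\<^sub>R e x - indicator T x *\<^sub>R e x" for x
  proof -
    have "e x = exponential c x * exp (- 2 * of_real pi * \<i> * of_real (x \<bullet> \<xi>))"
      unfolding e_def exponential_def exp_add[symmetric]
      by (simp add: inner_diff_right algebra_simps)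
    then show ?thesis
      by (simp add: g_def indicator_def)
  qed
  show "fourier_on \<Omega> (g c) \<xi> = fourier_on S (\<lambda>_. 1) (\<xi> - c) - fourier_on T (\<lambda>_. 1) (\<xi> - c)"
    unfolding fourier_on_def[of \<Omega>] ge on[OF S] on[OF T]
    using int[OF S] int[OF T] by (rule Bochner_Integration.integral_diff)
qed

lemma borel_translate_image:
  fixes S :: "'a :: euclidean_space set"
  assumes "S \<in> sets borel"
  shows "(+) v ` S \<in> sets borel"
proof -
  have "(+) v ` S = (\<lambda>x. x - v) -` S \<inter> space borel"
    by (auto intro: image_eqI[where x = "x - v" for x])
  also have "\<dots> \<in> sets borel"
    by (rule measurable_sets[OF _ assms]) simp
  finally show ?thesis .
qed

lemma fourier_indicator_translate:
  fixes S :: "(real ^ 'n) set"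
  assumes S: "S \<in> sets borel"
  shows "fourier_on ((+) v ` S) (\<lambda>_. 1) \<eta>
      = exp (- 2 * of_real pi * \<i> * of_real (v \<bullet> \<eta>)) * fourier_on S (\<lambda>_. 1) \<eta>"
proof -
  define e :: "real ^ 'n \<Rightarrow> complex"
    where "e x = exp (- 2 * of_real pi * \<i> * of_real (x \<bullet> \<eta>))" for x
  have e_meas: "e \<in> borel_measurable borel"
    unfolding e_def by (intro borel_measurable_continuous_onI continuous_intros)
  have T: "(+) v ` S \<in> sets borel"
    using S by (rule borel_translate_image)
  have on: "fourier_on X (\<lambda>_. 1) \<eta> = (LINT x|lborel. indicator X x *\<^sub>R e x)"
    if X: "X \<in> sets borel" for X
  proof -
    have "fourier_on X (\<lambda>_. 1) \<eta> = (LINT x|lebesgue. indicator X x *\<^sub>R e x)"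
      unfolding fourier_on_def using X by (simp add: integral_restrict_space e_def)
    also have "\<dots> = (LINT x|lborel. indicator X x *\<^sub>R e x)"
      using e_meas X by (intro integral_completion borel_measurable_scaleR borel_measurable_indicator) auto
    finally show ?thesis .
  qed
  have "fourier_on ((+) v ` S) (\<lambda>_. 1) \<eta>
      = (LINT x|distr lborel borel ((+) v). indicator ((+) v ` S) x *\<^sub>R e x)"
    by (simp add: on[OF T] lborel_distr_plus)
  also have "\<dots> = (LINT x|lborel. indicator ((+) v ` S) (v + x) *\<^sub>R e (v + x))"
    using T e_meas by (intro integral_distr borel_measurable_scaleR borel_measurable_indicator) auto
  also have "\<dots> = (LINT x|lborel. e v * (indicator S x *\<^sub>R e x))"
  proof (rule Bochner_Integration.integral_cong[OF refl])
    fix x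
    have "e (v + x) = e v * e x"
      unfolding e_def exp_add[symmetric] by (simp add: inner_add_left algebra_simps)
    moreover have "v + x \<in> (+) v ` S \<longleftrightarrow> x \<in> S"
      by auto
    ultimately show "indicator ((+) v ` S) (v + x) *\<^sub>R e (v + x) = e v * (indicator S x *\<^sub>R e x)"
      by (simp add: indicator_def)
  qed
  also have "\<dots> = e v * fourier_on S (\<lambda>_. 1) \<eta>"
    by (simp only: on[OF S] integral_mult_right_zero)
  finally show ?thesis
    by (simp add: e_def)
qed

text \<open>Moving a cube by \<open>t\<close> along a coordinate axis uncovers a slab of width \<open>t\<close> at one face and adds
  one at the opposite face. The linear dependence on \<open>t\<close> is what produces the factor \<open>1 / R\<close> in the
  end.\<close>

lemma cube_translate_sym_diff_measure:
  fixes b :: "real ^ 'n"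
  assumes t: "0 \<le> t" "t \<le> s"
  shows "measure lborel (sym_diff (box b (b + vec s)) ((+) (axis j t) ` box b (b + vec s)))
      \<le> 2 * t * s ^ (CARD('n) - 1)"
proof -
  let ?S = "box b (b + vec s)"
  define w :: "real ^ 'n" where "w = (\<chi> i. if i = j then t else s)"
  \<comment> \<open>the slabs at the lower and at the upper face\<close>
  let ?P = "cbox b (b + w)"
  let ?P' = "cbox (b + axis j s) (b + axis j s + w)"
  have prod_w: "(\<Prod>i\<in>UNIV. w $ i) = t * s ^ (CARD('n) - 1)"
  proof -
    have "(\<Prod>i\<in>UNIV. w $ i) = w $ j * (\<Prod>i\<in>UNIV - {j}. w $ i)"
      by (rule prod.remove) auto
    also have "(\<Prod>i\<in>UNIV - {j}. w $ i) = (\<Prod>i\<in>UNIV - {j}. s)"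
      by (rule prod.cong) (auto simp: w_def)
    finally show ?thesis
      by (simp add: w_def card_Diff_singleton)
  qed
  have content: "measure lborel (cbox a (a + w)) = t * s ^ (CARD('n) - 1)" for a
  proof -
    have "cbox a (a + w) \<noteq> {}"
      using t by (auto simp: interval_ne_empty_cart w_def)
    then show ?thesis
      by (simp add: content_cbox_cart prod_w)
  qed
  have "sym_diff ?S ((+) (axis j t) ` ?S) \<subseteq> ?P \<union> ?P'"
  proof
    fix x
    assume "x \<in> sym_diff ?S ((+) (axis j t) ` ?S)"
    then consider "x \<in> ?S" "x - axis j t \<notin> ?S" | "x \<notin> ?S" "x - axis j t \<in> ?S"
      by (auto simp: image_iff) (metis add_diff_cancel_left' add.commute diff_add_cancel)
    then show "x \<in> ?P \<union> ?P'"
    proof cases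
      case 1
      then have S: "b $ i < x $ i" "x $ i < b $ i + s" for i
        by (auto simp: mem_box_cart)
      obtain i where i: "\<not> (b $ i < x $ i - axis j t $ i \<and> x $ i - axis j t $ i < b $ i + s)"
        using 1(2) by (auto simp: mem_box_cart)
      have "i = j" using i S[of i] by (auto simp: axis_def split: if_splits)
      with i S[of j] t have "x $ j \<le> b $ j + t"
        by (auto simp: axis_def)
      with S have "x \<in> ?P"
        by (auto simp: mem_box_cart w_def less_imp_le)
      then show ?thesis ..
    next
      case 2
      then have S: "b $ i < x $ i - axis j t $ i" "x $ i - axis j t $ i < b $ i + s" for i
        by (auto simp: mem_box_cart)
      obtain i where i: "\<not> (b $ i < x $ i \<and> x $ i < b $ i + s)"
        using 2(1) by (auto simp: mem_box_cart)
      have "i = j" using i S[of i] by (auto simp: axis_def split: if_splits)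
      with i S[of j] t have j: "b $ j + s \<le> x $ j" "x $ j \<le> b $ j + s + t"
        by (auto simp: axis_def)
      have "b $ i \<le> x $ i \<and> x $ i \<le> b $ i + s" if "i \<noteq> j" for i
        using S[of i] that by (auto simp: axis_def)
      with j have "x \<in> ?P'"
        by (auto simp: mem_box_cart w_def axis_def)
      then show ?thesis ..
    qed
  qed
  then have "measure lborel (sym_diff ?S ((+) (axis j t) ` ?S)) \<le> measure lborel (?P \<union> ?P')"
    by (rule measure_mono_fmeasurable)
       (simp_all add: borel_translate_image fmeasurable.Un sets.Diff sets.Un)
  also have "\<dots> \<le> measure lborel ?P + measure lborel ?P'"
    by (intro measure_Un_le) auto
  finally show ?thesis
    by (simp add: content)
qed

section \<open>Averaging over translations\<close>

text \<open>The integrand equals \<open>2 - 2 cos (2 \<pi> u t)\<close>, whose integral differs from \<open>2 T\<close> by at most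
  \<open>1 / (\<pi> \<bar>u\<bar>)\<close>. The hypothesis makes this error at most \<open>T\<close>, uniformly in how large \<open>\<bar>u\<bar>\<close> is. A
  finite set of times \<open>t\<close> could not replace the integral: some large \<open>u\<close> is almost resonant with
  all of them.\<close>

lemma norm_one_minus_character_integral:
  fixes u T :: real
  assumes "0 < T" "1 \<le> 2 * T * \<bar>u\<bar>"
  shows "\<exists>I. T \<le> I \<and> ((\<lambda>t. (norm (1 - exp (- 2 * of_real pi * \<i> * of_real (t * u))))\<^sup>2) has_integral I) {0..T}"
proof -
  define \<theta> where "\<theta> = 2 * pi * u"
  have u: "u \<noteq> 0" using assms by auto
  then have \<theta>: "\<theta> \<noteq> 0" by (simp add: \<theta>_def)
  have eq: "(norm (1 - exp (- 2 * of_real pi * \<i> * of_real (t * u))))\<^sup>2 = 2 - 2 * cos (\<theta> * t)" for t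
  proof -
    have "exp (- 2 * of_real pi * \<i> * of_real (t * u)) = cis (- (\<theta> * t))"
      by (simp add: cis_conv_exp \<theta>_def mult_ac)
    then have "(norm (1 - exp (- 2 * of_real pi * \<i> * of_real (t * u))))\<^sup>2
        = (1 - cos (\<theta> * t))\<^sup>2 + (sin (\<theta> * t))\<^sup>2"
      by (simp add: cmod_power2)
    also have "\<dots> = 1 - 2 * cos (\<theta> * t) + ((sin (\<theta> * t))\<^sup>2 + (cos (\<theta> * t))\<^sup>2)"
      by (simp add: power2_eq_square algebra_simps)
    finally show ?thesis by (simp only: sin_cos_squared_add)
  qed
  have "((\<lambda>t. 2 - 2 * cos (\<theta> * t)) has_integral
      ((2 * T - 2 * sin (\<theta> * T) / \<theta>) - (2 * 0 - 2 * sin (\<theta> * 0) / \<theta>))) {0..T}"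
    using assms(1) \<theta>
    by (intro fundamental_theorem_of_calculus)
       (auto intro!: derivative_eq_intros simp flip: has_real_derivative_iff_has_vector_derivative)
  moreover have "T \<le> 2 * T - 2 * sin (\<theta> * T) / \<theta>"
  proof -
    have "2 * 1 \<le> pi * (2 * T * \<bar>u\<bar>)"
      using pi_ge_two assms by (intro mult_mono) auto
    then have 1: "2 \<le> T * \<bar>\<theta>\<bar>"
      by (simp add: \<theta>_def abs_mult algebra_simps)
    have "2 * sin (\<theta> * T) / \<theta> \<le> \<bar>2 * sin (\<theta> * T) / \<theta>\<bar>"
      by (rule abs_ge_self)
    also have "\<dots> \<le> 2 / \<bar>\<theta>\<bar>"
      using \<theta> by (simp add: abs_mult divide_right_mono)
    also have "\<dots> \<le> T"
      using 1 \<theta> by (simp add: divide_le_eq)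
    finally show ?thesis by simp
  qed
  ultimately show ?thesis
    unfolding eq by (intro exI conjI) simp_all
qed

lemma frame_partial_sum_le:
  assumes "exponential_frame \<Omega> \<Lambda> A B" "g \<in> L2_on \<Omega>" "finite F" "F \<subseteq> \<Lambda>"
  shows "(\<Sum>\<xi>\<in>F. (norm (fourier_on \<Omega> g \<xi>))\<^sup>2) \<le> B * (L2_norm_on \<Omega> g)\<^sup>2"
proof -
  have "(\<Sum>\<xi>\<in>F. (norm (fourier_on \<Omega> g \<xi>))\<^sup>2) \<le> (\<Sum>\<^sub>\<infinity>\<xi>\<in>\<Lambda>. (norm (fourier_on \<Omega> g \<xi>))\<^sup>2)"
    using assms by (intro finite_sum_le_infsum) (auto simp: exponential_frame_def)
  also have "\<dots> \<le> B * (L2_norm_on \<Omega> g)\<^sup>2"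
    using assms by (auto simp: exponential_frame_def)
  finally show ?thesis .
qed

text \<open>Frequencies far from \<open>c\<close> in direction \<open>j\<close> carry little of the transform of a cube. The frame
  property itself is used to prove this: the upper frame bounds for the differences of \<open>S\<close> and
  its translates by \<open>t\<close> along the axis \<open>j\<close> are averaged over \<open>0 \<le> t \<le> T\<close>. A cube of twice the
  side in \<open>\<Omega>\<close> leaves room for these translates. Finite sets \<open>F\<close> suffice and avoid interchanging an
  integral with an infinite sum.\<close>

lemma cube_transform_tail:
  fixes b c :: "real ^ 'n"
  assumes \<Omega>: "\<Omega> \<in> sets lebesgue"
    and frame: "exponential_frame \<Omega> \<Lambda> A B"
    and cube: "box b (b + vec (2 * s)) \<subseteq> \<Omega>"
    and T: "0 < T" "T \<le> s"
    and F: "finite F" "F \<subseteq> \<Lambda>"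
    and far: "\<And>\<xi>. \<xi> \<in> F \<Longrightarrow> 1 \<le> 2 * T * \<bar>\<xi> $ j - c $ j\<bar>"
  shows "(\<Sum>\<xi>\<in>F. (norm (fourier_on (box b (b + vec s)) (\<lambda>_. 1) (\<xi> - c)))\<^sup>2)
      \<le> 2 * B * T * s ^ (CARD('n) - 1)"
proof -
  let ?S = "box b (b + vec s)"
  let ?G = "\<lambda>\<xi>. (norm (fourier_on ?S (\<lambda>_. 1) (\<xi> - c)))\<^sup>2"
  let ?K = "\<lambda>t \<xi>. (norm (1 - exp (- 2 * of_real pi * \<i> * of_real (t * (\<xi> $ j - c $ j)))))\<^sup>2"
  let ?M = "2 * B * T * s ^ (CARD('n) - 1)"
  have B: "0 < B" using frame by (simp add: exponential_frame_def)
  \<comment> \<open>the upper frame bound for one translation, relaxed to a bound that is constant in \<open>t\<close>\<close>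
  have bound: "(\<Sum>\<xi>\<in>F. ?G \<xi> * ?K t \<xi>) \<le> ?M" if t: "t \<in> {0..T}" for t
  proof -
    let ?S' = "(+) (axis j t) ` ?S"
    have S: "?S \<in> sets borel" "emeasure lborel ?S < \<infinity>" "?S \<subseteq> \<Omega>"
    proof -
      have "?S \<subseteq> box b (b + vec (2 * s))"
        using T by (auto simp: mem_box_cart) (smt (verit) vec_component)
      with cube show "?S \<subseteq> \<Omega>" by blast
    qed (use emeasure_lborel_box_finite in auto)
    have S': "?S' \<in> sets borel" "emeasure lborel ?S' < \<infinity>" "?S' \<subseteq> \<Omega>"
    proof -
      show "?S' \<in> sets borel" using S(1) by (rule borel_translate_image)
      have sub: "?S' \<subseteq> box b (b + vec (2 * s))"
      proof
        fix y assume "y \<in> ?S'"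
        then obtain x where x: "x \<in> ?S" "y = axis j t + x" by blast
        have "b $ i < y $ i \<and> y $ i < b $ i + 2 * s" for i
        proof -
          have "b $ i < x $ i" "x $ i < b $ i + s"
            using x(1) by (auto simp: mem_box_cart)
          then show ?thesis
            using t T x(2) by (auto simp: axis_def)
        qed
        then show "y \<in> box b (b + vec (2 * s))"
          by (simp add: mem_box_cart)
      qed
      with cube show "?S' \<subseteq> \<Omega>" by blast
      have "emeasure lborel ?S' \<le> emeasure lborel (box b (b + vec (2 * s)))"
        using sub by (intro emeasure_mono) auto
      also have "\<dots> < \<infinity>" by (rule emeasure_lborel_box_finite)
      finally show "emeasure lborel ?S' < \<infinity>" .
    qed
    let ?h = "\<lambda>x. exponential c x * (indicator ?S x - indicator ?S' x)"
    have four: "(norm (fourier_on \<Omega> ?h \<xi>))\<^sup>2 = ?G \<xi> * ?K t \<xi>" for \<xi>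
    proof -
      let ?f = "fourier_on ?S (\<lambda>_. 1) (\<xi> - c)"
      let ?k = "exp (- 2 * of_real pi * \<i> * of_real (t * (\<xi> $ j - c $ j)))"
      have "fourier_on \<Omega> ?h \<xi> = ?f - fourier_on ?S' (\<lambda>_. 1) (\<xi> - c)"
        by (rule modulated_indicator_fourier[OF \<Omega> S S'])
      also have "fourier_on ?S' (\<lambda>_. 1) (\<xi> - c) = ?k * ?f"
        unfolding fourier_indicator_translate[OF S(1)] by (simp add: inner_axis' mult_ac)
      finally have "fourier_on \<Omega> ?h \<xi> = ?f * (1 - ?k)"
        by (simp add: algebra_simps)
      then show ?thesis
        by (simp only: norm_mult power_mult_distrib)
    qed
    have "(\<Sum>\<xi>\<in>F. ?G \<xi> * ?K t \<xi>) \<le> B * (L2_norm_on \<Omega> ?h)\<^sup>2"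
      using frame_partial_sum_le[OF frame modulated_indicator_L2[OF \<Omega> S S', of c] F]
      unfolding four .
    also have "\<dots> \<le> B * (2 * t * s ^ (CARD('n) - 1))"
      unfolding modulated_indicator_norm[OF \<Omega> S S']
      using B t T by (intro mult_left_mono cube_translate_sym_diff_measure) auto
    also have "\<dots> \<le> ?M"
      using B t T by (auto intro!: mult_right_mono)
    finally show ?thesis .
  qed
  have "\<forall>\<xi>\<in>F. \<exists>I. T \<le> I \<and> ((\<lambda>t. ?K t \<xi>) has_integral I) {0..T}"
    using norm_one_minus_character_integral[OF T(1) far] by blast
  then obtain I where I: "\<And>\<xi>. \<xi> \<in> F \<Longrightarrow> T \<le> I \<xi>"
      "\<And>\<xi>. \<xi> \<in> F \<Longrightarrow> ((\<lambda>t. ?K t \<xi>) has_integral I \<xi>) {0..T}"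
    by metis
  have "((\<lambda>t. \<Sum>\<xi>\<in>F. ?G \<xi> * ?K t \<xi>) has_integral (\<Sum>\<xi>\<in>F. ?G \<xi> * I \<xi>)) {0..T}"
    by (intro has_integral_sum F has_integral_mult_right I)
  moreover have "((\<lambda>t. ?M) has_integral (T * ?M)) {0..T}"
    using has_integral_const_real[of ?M 0 T] T by simp
  ultimately have "(\<Sum>\<xi>\<in>F. ?G \<xi> * I \<xi>) \<le> T * ?M"
    using bound by (rule has_integral_le)
  moreover have "T * (\<Sum>\<xi>\<in>F. ?G \<xi>) \<le> (\<Sum>\<xi>\<in>F. ?G \<xi> * I \<xi>)"
    unfolding sum_distrib_left by (intro sum_mono) (auto simp: mult.commute intro!: mult_right_mono I)
  ultimately have "T * (\<Sum>\<xi>\<in>F. ?G \<xi>) \<le> T * ?M"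
    by linarith
  then show ?thesis
    using T by (simp only: mult_le_cancel_left_pos)
qed

section \<open>The size of a spectral gap\<close>

text \<open>A frequency outside the gap is far from its centre in at least one of the \<open>d\<close> coordinate
  directions, so \<open>d\<close> applications of the tail bound with \<open>T = 1 / R\<close> control all of \<open>\<Lambda>\<close>, while
  the lower frame bound prevents the whole sum from being small.\<close>

lemma gap_estimate:
  fixes \<Omega> \<Lambda> :: "(real ^ 'n) set"
  assumes \<Omega>: "\<Omega> \<in> sets lebesgue"
    and frame: "exponential_frame \<Omega> \<Lambda> A B"
    and R: "0 < R" and gap: "box a (a + vec R) \<inter> \<Lambda> = {}"
    and \<epsilon>: "0 < \<epsilon>" and cube: "box b (b + vec \<epsilon>) \<subseteq> \<Omega>"
  shows "R \<le> 4 * CARD('n) * (B / A) * inverse \<epsilon>"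
proof -
  define s where "s = \<epsilon> / 2"
  have s: "0 < s" "\<epsilon> = 2 * s" using \<epsilon> by (auto simp: s_def)
  have AB: "0 < A" "0 < B" using frame by (auto simp: exponential_frame_def)
  define c where "c = a + vec (R / 2)"
  let ?S = "box b (b + vec s)"
  let ?d = "CARD('n)"
  let ?g = "\<lambda>x. exponential c x * (indicator ?S x - indicator {} x)"
  let ?G = "\<lambda>\<xi>. (norm (fourier_on \<Omega> ?g \<xi>))\<^sup>2"
  have S: "?S \<in> sets borel" "emeasure lborel ?S < \<infinity>" "?S \<subseteq> \<Omega>"
  proof -
    have "?S \<subseteq> box b (b + vec \<epsilon>)"
      using s by (auto simp: mem_box_cart) (smt (verit) vec_component)
    with cube show "?S \<subseteq> \<Omega>" by blast
  qed (use emeasure_lborel_box_finite in auto)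
  have E: "{} \<in> sets borel" "emeasure lborel ({} :: (real ^ 'n) set) < \<infinity>" "{} \<subseteq> \<Omega>"
    by auto
  note L2 = modulated_indicator_L2[OF \<Omega> S E, of c]
  have nrm: "(L2_norm_on \<Omega> ?g)\<^sup>2 = s ^ ?d"
  proof -
    have "vec s \<bullet> i = s" if "i \<in> Basis" for i :: "real ^ 'n"
      using that by (auto simp: Basis_vec_def inner_axis)
    then have "measure lborel ?S = s ^ ?d"
      using s by (subst measure_lborel_box) (simp_all add: inner_add_left)
    then show ?thesis
      unfolding modulated_indicator_norm[OF \<Omega> S E] by simp
  qed
  have four: "?G \<xi> = (norm (fourier_on ?S (\<lambda>_. 1) (\<xi> - c)))\<^sup>2" for \<xi>
    unfolding modulated_indicator_fourier[OF \<Omega> S E]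
    by (simp add: fourier_on_def integral_restrict_space)
  have lower: "A * s ^ ?d \<le> (\<Sum>\<^sub>\<infinity>\<xi>\<in>\<Lambda>. ?G \<xi>)" and upper: "(\<Sum>\<^sub>\<infinity>\<xi>\<in>\<Lambda>. ?G \<xi>) \<le> B * s ^ ?d"
    and summable: "?G summable_on \<Lambda>"
    using frame[unfolded exponential_frame_def] bspec[OF _ L2] unfolding nrm[symmetric] by blast+
  show ?thesis
  proof (cases "1 / R \<le> s")
    case False
    \<comment> \<open>The gap is short: comparing the two frame bounds on a nonzero function suffices.\<close>
    have "A * s ^ ?d \<le> B * s ^ ?d" using lower upper by linarith
    then have "A \<le> B" using s by simp
    then have "1 * 1 \<le> ?d * (B / A)"
      using AB by (intro mult_mono) (auto simp: Suc_le_eq)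
    moreover have "R * \<epsilon> \<le> 2"
      using False R s by (simp add: field_simps)
    ultimately have "R * \<epsilon> \<le> 4 * ?d * (B / A)"
      by linarith
    then show ?thesis
      using \<epsilon> by (simp only: pos_le_divide_eq divide_inverse[symmetric])
  next
    case True
    define Far where "Far j = {\<xi>. R / 2 \<le> \<bar>\<xi> $ j - c $ j\<bar>}" for j
    have cover: "\<exists>j. \<xi> \<in> Far j" if "\<xi> \<in> \<Lambda>" for \<xi>
    proof -
      have "\<xi> \<notin> box a (a + vec R)" using gap that by blast
      then obtain j where "\<not> (a $ j < \<xi> $ j \<and> \<xi> $ j < a $ j + R)"
        by (auto simp: mem_box_cart)
      then have "\<xi> \<in> Far j" by (auto simp: Far_def c_def field_simps abs_if)
      then show ?thesis ..
    qed
    let ?M = "2 * B * (1 / R) * s ^ (?d - 1)"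
    have "(\<Sum>\<^sub>\<infinity>\<xi>\<in>\<Lambda>. ?G \<xi>) \<le> ?d * ?M"
    proof (rule infsum_le_finite_sums[OF summable])
      fix F assume F: "finite F" "F \<subseteq> \<Lambda>"
      have "(\<Sum>\<xi>\<in>F. ?G \<xi>) \<le> (\<Sum>\<xi>\<in>F. \<Sum>j\<in>UNIV. if \<xi> \<in> Far j then ?G \<xi> else 0)"
      proof (rule sum_mono)
        fix \<xi> assume "\<xi> \<in> F"
        then obtain j where "\<xi> \<in> Far j" using F cover by blast
        then have "?G \<xi> = (if \<xi> \<in> Far j then ?G \<xi> else 0)" by simp
        also have "\<dots> \<le> (\<Sum>j\<in>UNIV. if \<xi> \<in> Far j then ?G \<xi> else 0)"
          by (rule member_le_sum) auto
        finally show "?G \<xi> \<le> (\<Sum>j\<in>UNIV. if \<xi> \<in> Far j then ?G \<xi> else 0)" .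
      qed
      also have "\<dots> = (\<Sum>j\<in>UNIV. \<Sum>\<xi>\<in>F \<inter> Far j. ?G \<xi>)"
        by (subst sum.swap) (simp only: sum.inter_restrict[OF F(1)])
      also have "\<dots> \<le> (\<Sum>j\<in>(UNIV :: 'n set). ?M)"
      proof (rule sum_mono)
        fix j :: 'n
        show "(\<Sum>\<xi>\<in>F \<inter> Far j. ?G \<xi>) \<le> ?M"
          unfolding four
          using cube True F R
          by (intro cube_transform_tail[OF \<Omega> frame]) (auto simp: s Far_def field_simps)
      qed
      also have "\<dots> = ?d * ?M" by simp
      finally show "(\<Sum>\<xi>\<in>F. ?G \<xi>) \<le> ?d * ?M" .
    qed
    with lower have "A * s ^ ?d \<le> ?d * ?M" by linarith
    moreover have "s ^ ?d = s * s ^ (?d - 1)"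
      by (simp flip: power_Suc)
    ultimately have "(A * s) * s ^ (?d - 1) \<le> (?d * (2 * B * (1 / R))) * s ^ (?d - 1)"
      by (simp add: mult_ac)
    then have "A * s \<le> ?d * (2 * B * (1 / R))"
      using s by (simp only: mult_le_cancel_right_pos zero_less_power)
    then show ?thesis
      using AB R s by (simp add: field_simps)
  qed
qed

theorem theorem2:
  shows "\<exists>C::real. 0 < C \<and>
    (\<forall>(\<Omega> :: (real ^ 'n) set) (\<Lambda> :: (real ^ 'n) set) (A :: real) (B :: real) (R :: real) (\<epsilon> :: real).
       \<Omega> \<in> sets lebesgue \<longrightarrow>
       0 < emeasure lebesgue \<Omega> \<longrightarrow>
       exponential_frame \<Omega> \<Lambda> A B \<longrightarrow>
       0 < R \<longrightarrow>
       (\<exists>Q. is_cube R Q \<and> Q \<inter> \<Lambda> = {}) \<longrightarrow>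
       0 < \<epsilon> \<longrightarrow>
       (\<exists>Q. is_cube \<epsilon> Q \<and> Q \<subseteq> \<Omega>) \<longrightarrow>
       R \<le> C * (B / A) * inverse \<epsilon>)"
proof (intro exI[of _ "real (4 * CARD('n))"] conjI allI impI; (elim exE conjE)?)
  show "0 < real (4 * CARD('n))" by simp
next
  fix \<Omega> \<Lambda> Q Q' :: "(real ^ 'n) set" and A B R \<epsilon> :: real
  assume *: "\<Omega> \<in> sets lebesgue" "exponential_frame \<Omega> \<Lambda> A B" "0 < R"
    and "0 < \<epsilon>" "is_cube R Q" "Q \<inter> \<Lambda> = {}" "is_cube \<epsilon> Q'" "Q' \<subseteq> \<Omega>"
  then obtain a b where "box a (a + vec R) \<inter> \<Lambda> = {}" "box b (b + vec \<epsilon>) \<subseteq> \<Omega>"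
    unfolding is_cube_def by blast
  with * \<open>0 < \<epsilon>\<close> show "R \<le> real (4 * CARD('n)) * (B / A) * inverse \<epsilon>"
    using gap_estimate[of \<Omega> \<Lambda> A B R a \<epsilon> b] by simp
qed

end
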